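(* For every integer $n\ge 0$, \begin{align*} H_{5n}(F(x,5))&=H_{5n+1}(F(x,5))=1, \\ H_{5n+2}(F(x,5))&=- H_{5n+4}(F(x,5))=-5(n+1),\\ H_{5n+3}(F(x,5))&=0. \end{align*}
   Context: For a power series $A(x)=\sum_{n\ge 0}a_nx^n$, the Hankel determinants are $H_n(A(x))=\det(a_{i+j})_{0\le i,j\le n-1}$ for $n\ge 1$, with $H_0(A(x))=1$. Let $C(x)=\sum_{n\ge0}C_nx^n$ with $C_n=\frac1{n+1}\binom{2n}{n}$ be the Catalan generating function (the unique power series with $C(x)=1+xC(x)^2$), and $F(x,r)=C(x)^r=\sum_{n\ge 0}\frac{r}{2n+r}\binom{2n+r}{n}x^n$ for positive integers $r$. *)

theory Defs
  imports Complex_Main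
    "HOL-Computational_Algebra.Formal_Power_Series"
    "Jordan_Normal_Form.Determinant"
begin

definition hankel_det :: "'a::comm_ring_1 fps \<Rightarrow> nat \<Rightarrow> 'a" where
  "hankel_det A n = det (mat n n (\<lambda>(i, j). fps_nth A (i + j)))"

lemma hankel_det_0: "hankel_det A 0 = 1"
  by (simp add: hankel_det_def det_dim_zero)

definition catalan_fps :: "rat fps" where
  "catalan_fps = Abs_fps (\<lambda>n. of_nat ((2 * n) choose n) / of_nat (n + 1))"

definition F :: "nat \<Rightarrow> rat fps" where
  "F r = catalan_fps ^ r"

end

theory Submission
  imports Defs
begin

text \<open>
  Let \<open>L\<close> be the linear functional on polynomials in \<open>y\<close> whose moments \<open>L(y\<^sup>n)\<close> are the coefficients of
  \<open>C\<^sup>5\<close>. Any monic basis change \<open>p\<^sub>0, p\<^sub>1, \<dots>\<close> replaces the Hankel matrix by the Gram matrix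
  \<open>L(p\<^sub>k p\<^sub>l)\<close> without altering its leading principal minors. Put \<open>y = z + 2 + 1/z\<close> and take the
  Chebyshev polynomials \<open>p\<^sub>k = (z\<^bsup>k+1\<^esup> - z\<^bsup>-k-1\<^esup>) / (z - 1/z)\<close>, for which
  \<open>y p\<^sub>k = p\<^bsub>k-1\<^esub> + 2 p\<^sub>k + p\<^bsub>k+1\<^esub>\<close>. The equation \<open>C = 1 + x C\<^sup>2\<close> shows that \<open>y\<^sup>n\<close> has the
  coordinates \<open>riordan n k = [x\<^sup>n] (x C\<^sup>2)\<^sup>k C\<^sup>2\<close>, and \<open>C\<^sup>5 = (1 + x C\<^sup>2)\<^sup>3 C\<^sup>2\<close> then reads
  \<open>L(p\<^sub>l) = 1, 3, 3, 1, 0, 0, \<dots>\<close>. So the Gram matrix is banded, and away from its corner it is the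
  Toeplitz matrix with symbol \<open>(1 + z) (1 + 1/z) (z\<^sup>2 + z + 1 + z\<^bsup>-1\<^esup> + z\<^bsup>-2\<^esup>)\<close>. This is the content of
  \<open>F5_factorization\<close> and \<open>hankel_det_F5\<close>.

  The last factor of the symbol is \<open>(z\<^sup>5 - 1) / (z\<^sup>2 (z - 1))\<close>, which is where the period \<open>5\<close> comes from:
  block elimination of the first five rows reproduces the same matrix except for a change of
  rank one in the corner. Precisely, let \<open>gram m\<close> be the Gram matrix with \<open>5 m\<close> subtracted from the
  four entries with both indices in \<open>{1, 2}\<close>. Its leading \<open>5 \<times> 5\<close> minor is \<open>1\<close>, and the Schur
  complement of that block is \<open>gram (m + 1)\<close> (\<open>gram_elimination\<close>). Hence the minor of size
  \<open>5 n + k\<close> of \<open>gram 0\<close> equals the minor of size \<open>k\<close> of \<open>gram n\<close>, and the five minors with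
  \<open>k < 5\<close> are computed directly; the linear growth in \<open>n\<close> is the growth of the corner entries,
  and the minor of size \<open>3\<close> vanishes because its last two rows agree.
\<close>

section \<open>The Catalan series\<close>

lemma catalan_fps_nth_0: "fps_nth catalan_fps 0 = 1"
  by (simp add: catalan_fps_def)

lemma catalan_nth_Suc:
  "of_nat (n + 2) * fps_nth catalan_fps (Suc n) = of_nat (4 * n + 2) * fps_nth catalan_fps n"
proof -
  have 1: "Suc n * ((2 * Suc n) choose Suc n) = (2 * n + 2) * ((2 * n + 1) choose n)"
    using Suc_times_binomial_eq[of "2 * n + 1" n] by simp
  have 2: "Suc n * ((2 * n + 1) choose Suc n) = (2 * n + 1) * ((2 * n) choose n)"
    using Suc_times_binomial_eq[of "2 * n" n] by (simp add: mult.commute)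
  have 3: "(2 * n + 1) choose Suc n = (2 * n + 1) choose n"
    using binomial_symmetric[of n "2 * n + 1"] by simp
  have "Suc n * ((2 * Suc n) choose Suc n) = Suc n * (2 * ((2 * n + 1) choose n))"
    unfolding 1 by simp
  then have "(2 * Suc n) choose Suc n = 2 * ((2 * n + 1) choose n)"
    by (simp only: mult_cancel1) simp
  then have "Suc n * ((2 * Suc n) choose Suc n) = 2 * (Suc n * ((2 * n + 1) choose Suc n))"
    unfolding 3 by simp
  then have "Suc n * ((2 * Suc n) choose Suc n) = (4 * n + 2) * ((2 * n) choose n)"
    unfolding 2 by (simp del: binomial_Suc_Suc)
  then have "(of_nat (Suc n) :: rat) * of_nat ((2 * Suc n) choose Suc n)
      = of_nat (4 * n + 2) * of_nat ((2 * n) choose n)"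
    by (metis of_nat_mult)
  then show ?thesis
    by (simp add: catalan_fps_def field_simps del: binomial_Suc_Suc mult_Suc_right)
qed

text \<open>
  The square of \<open>D = 1 - 2 x C\<close> should be \<open>1 - 4 x\<close>. The two-term recurrence of the Catalan
  numbers says that \<open>(1 - 4 x) D' = - 2 D\<close>, so \<open>D\<^sup>2\<close> and \<open>1 - 4 x\<close> both solve
  \<open>(1 - 4 x) A' = - 4 A\<close>. Their difference \<open>Y\<close> starts with \<open>0\<close> and hence vanishes.
\<close>
lemma catalan_fps_equation: "catalan_fps = 1 + fps_X * catalan_fps\<^sup>2"
proof -
  let ?c = "fps_const :: rat \<Rightarrow> rat fps"
  define D where "D = 1 - ?c 2 * (fps_X * catalan_fps)"
  define Y where "Y = D\<^sup>2 - (1 - ?c 4 * fps_X)"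
  have D_nth: "fps_nth D 0 = 1" "\<And>n. fps_nth D (Suc n) = - 2 * fps_nth catalan_fps n"
    by (simp_all add: D_def)
  have ode: "fps_deriv D - ?c 4 * (fps_X * fps_deriv D) = - (?c 2 * D)"
  proof (rule fps_ext)
    fix n
    show "fps_nth (fps_deriv D - ?c 4 * (fps_X * fps_deriv D)) n = fps_nth (- (?c 2 * D)) n"
    proof (cases n)
      case 0
      then show ?thesis
        by (simp add: D_nth catalan_fps_nth_0)
    next
      case (Suc k)
      have "fps_nth (fps_deriv D - ?c 4 * (fps_X * fps_deriv D)) n
          = - 2 * (of_nat (k + 2) * fps_nth catalan_fps (Suc k))
            + 8 * (of_nat (Suc k) * fps_nth catalan_fps k)"
        by (simp add: Suc D_nth)
      also have "\<dots> = 4 * fps_nth catalan_fps k"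
        unfolding catalan_nth_Suc by (simp add: algebra_simps)
      finally show ?thesis
        by (simp add: Suc D_nth)
    qed
  qed
  have "fps_deriv (D\<^sup>2) - ?c 4 * (fps_X * fps_deriv (D\<^sup>2))
      = ?c 2 * D * (fps_deriv D - ?c 4 * (fps_X * fps_deriv D))"
    by (simp add: power2_eq_square algebra_simps fps_numeral_fps_const)
  also have "\<dots> = - (?c 4 * D\<^sup>2)"
    unfolding ode by (simp add: power2_eq_square algebra_simps fps_numeral_fps_const)
  finally have odeY: "fps_deriv Y - ?c 4 * (fps_X * fps_deriv Y) = - (?c 4 * Y)"
    by (simp add: Y_def algebra_simps)
  have "fps_nth Y n = 0" for n
  proof (induction n)
    case 0
    show ?case
      by (simp add: Y_def D_def power2_eq_square)
  next
    case (Suc n)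
    have coeff: "fps_nth (fps_deriv Y - ?c 4 * (fps_X * fps_deriv Y)) n = fps_nth (- (?c 4 * Y)) n"
      using odeY by simp
    show ?case
    proof (cases n)
      case 0
      with coeff Suc.IH show ?thesis
        by simp
    next
      case (Suc k)
      with coeff Suc.IH
      have "of_nat (k + 2) * fps_nth Y (Suc n) = 0"
        by (simp add: algebra_simps)
      then show ?thesis
        by (simp only: mult_eq_0_iff of_nat_eq_0_iff) simp
    qed
  qed
  then have "Y = 0"
    by (simp add: fps_eq_iff)
  then have "?c 4 * (fps_X * (1 + fps_X * catalan_fps\<^sup>2 - catalan_fps)) = 0"
    unfolding Y_def D_def by (simp add: power2_eq_square algebra_simps fps_numeral_fps_const)
  then show ?thesis
    by simp
qed

section \<open>Congruences and elimination\<close>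

text \<open>
  Multiplication by \<open>y\<close> in the Chebyshev basis: the tridiagonal matrix with rows \<open>1, 2, 1\<close>, which is
  symmetric and therefore acts in the same way on coordinates and on the values of a functional.
\<close>
definition shift121 :: "(nat \<Rightarrow> 'a::comm_ring_1) \<Rightarrow> nat \<Rightarrow> 'a" where
  "shift121 g k = (if k = 0 then 0 else g (k - 1)) + 2 * g k + g (Suc k)"

text \<open>
  Symmetry of the tridiagonal matrix, as summation by parts. The vanishing condition includes the
  index \<open>N - 1\<close>, whose shift would otherwise leave the range of summation.
\<close>
lemma sum_shift121:
  assumes "\<And>k. N \<le> Suc k \<Longrightarrow> s k = 0"
  shows "(\<Sum>k<N. shift121 s k * g k) = (\<Sum>k<N. s k * shift121 g k)"
proof (cases N)
  case (Suc M)
  have "(\<Sum>k<N. (if k = 0 then 0 else s (k - 1)) * g k) = (\<Sum>k<M. s k * g (Suc k))"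
    unfolding Suc by (subst sum.lessThan_Suc_shift) simp
  moreover have "(\<Sum>k<N. s (Suc k) * g k) = (\<Sum>k<M. s (Suc k) * g k)"
    unfolding Suc using assms Suc by simp
  moreover have "(\<Sum>k<N. s k * (if k = 0 then 0 else g (k - 1))) = (\<Sum>k<M. s (Suc k) * g k)"
    unfolding Suc by (subst sum.lessThan_Suc_shift) simp
  moreover have "(\<Sum>k<N. s k * g (Suc k)) = (\<Sum>k<M. s k * g (Suc k))"
    unfolding Suc using assms Suc by simp
  ultimately show ?thesis
    by (simp add: shift121_def distrib_left distrib_right sum.distrib mult.assoc mult.left_commute
        del: mult_eq_0_iff)
qed simp

text \<open>
  If the rows of \<open>S\<close> are the coordinates of \<open>y\<^sup>0, y\<^sup>1, \<dots>\<close> and multiplication by \<open>y\<close> is self-adjoint for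
  the bilinear form \<open>K\<close>, then the factors \<open>y\<close> of \<open>y\<^sup>i\<close> can be moved one at a time to the other
  argument: \<open>K(y\<^sup>i, y\<^sup>j) = K(1, y\<^bsup>i+j\<^esup>)\<close>. Thus \<open>S K S\<^sup>T\<close> is a Hankel matrix, whose entries are
  read off from the first row of \<open>K\<close>.
\<close>
lemma hankel_of_commuting_form:
  fixes S K :: "nat \<Rightarrow> nat \<Rightarrow> 'a::comm_ring_1"
  assumes S0: "\<And>k. S 0 k = (if k = 0 then 1 else 0)"
    and S_Suc: "\<And>n. S (Suc n) = shift121 (S n)"
    and S_supp: "\<And>n k. n < k \<Longrightarrow> S n k = 0"
    and comm: "\<And>k l. shift121 (\<lambda>k. K k l) k = shift121 (K k) l"
    and N: "i + j + 1 < N"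
  shows "(\<Sum>k<N. \<Sum>l<N. S i k * K k l * S j l) = (\<Sum>l<N. K 0 l * S (i + j) l)"
  using N
proof (induction i arbitrary: j)
  case 0
  then obtain M where "N = Suc M"
    by (cases N) auto
  then show ?case
    by (subst (1) \<open>N = Suc M\<close>, subst sum.lessThan_Suc_shift) (simp add: S0)
next
  case (Suc i)
  have "(\<Sum>k<N. \<Sum>l<N. S (Suc i) k * K k l * S j l)
      = (\<Sum>l<N. (\<Sum>k<N. shift121 (S i) k * K k l) * S j l)"
    by (subst sum.swap) (simp add: S_Suc sum_distrib_right)
  also have "\<dots> = (\<Sum>l<N. (\<Sum>k<N. S i k * shift121 (K k) l) * S j l)"
    using Suc.prems by (subst sum_shift121) (auto simp: S_supp comm)
  also have "\<dots> = (\<Sum>k<N. S i k * (\<Sum>l<N. S j l * shift121 (K k) l))"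
    by (simp add: sum_distrib_right sum_distrib_left, subst sum.swap) (simp add: ac_simps)
  also have "\<dots> = (\<Sum>k<N. S i k * (\<Sum>l<N. shift121 (S j) l * K k l))"
    using Suc.prems by (subst sum_shift121) (auto simp: S_supp)
  also have "\<dots> = (\<Sum>k<N. \<Sum>l<N. S i k * K k l * S (Suc j) l)"
    by (simp add: S_Suc sum_distrib_left ac_simps)
  also have "\<dots> = (\<Sum>l<N. K 0 l * S (i + Suc j) l)"
    using Suc.prems by (intro Suc.IH) simp
  finally show ?case
    by simp
qed

lemma det_unitriangular_congruence:
  fixes S K :: "nat \<Rightarrow> nat \<Rightarrow> 'a::comm_ring_1"
  assumes supp: "\<And>i k. i < k \<Longrightarrow> S i k = 0" and diag: "\<And>i. S i i = 1"
  shows "det (mat n n (\<lambda>(i, j). \<Sum>k<n. \<Sum>l<n. S i k * K k l * S j l)) = det (mat n n (\<lambda>(i, j). K i j))"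
proof -
  let ?S = "mat n n (\<lambda>(i, j). S i j)" and ?K = "mat n n (\<lambda>(i, j). K i j)"
  have "mat n n (\<lambda>(i, j). \<Sum>k<n. \<Sum>l<n. S i k * K k l * S j l) = ?S * ?K * transpose_mat ?S"
    by (rule eq_matI)
      (auto simp: scalar_prod_def sum_distrib_right atLeast0LessThan intro: sum.swap)
  moreover have "det ?S = 1"
    by (subst det_lower_triangular[where n = n]) (auto simp: supp diag prod_list_diag_prod)
  moreover have "det (?S * ?K * transpose_mat ?S) = det ?S * det ?K * det ?S"
    by (subst det_mult[where n = n], auto)+ (auto simp: det_transpose[where n = n] det_mult[where n = n])
  ultimately show ?thesis
    by simp
qed

text \<open>
  The Schur complement formula. Instead of inverting the leading block, the hypotheses supply the
  multipliers \<open>L\<close> that clear the columns below it, and name the resulting complement \<open>K'\<close>. They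
  concern infinite matrices, so that one choice of \<open>L\<close> and \<open>K'\<close> serves all truncations.
\<close>
lemma det_block_elimination:
  fixes K K' L :: "nat \<Rightarrow> nat \<Rightarrow> 'a::idom"
  assumes top: "\<And>i j. j < r \<Longrightarrow> (\<Sum>q<r. L i q * K q j) = K (r + i) j"
    and bot: "\<And>i j. (\<Sum>q<r. L i q * K q (r + j)) + K' i j = K (r + i) (r + j)"
  shows "det (mat (r + n) (r + n) (\<lambda>(i, j). K i j))
    = det (mat r r (\<lambda>(i, j). K i j)) * det (mat n n (\<lambda>(i, j). K' i j))"
proof -
  let ?D = "mat r r (\<lambda>(i, j). K i j)" and ?B = "mat r n (\<lambda>(i, j). K i (r + j))"
    and ?L = "mat n r (\<lambda>(i, j). L i j)" and ?K' = "mat n n (\<lambda>(i, j). K' i j)"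
  let ?U = "four_block_mat (1\<^sub>m r) (0\<^sub>m r n) ?L (1\<^sub>m n)"
    and ?V = "four_block_mat ?D ?B (0\<^sub>m n r) ?K'"
  have LD: "?L * ?D = mat n r (\<lambda>(i, j). K (r + i) j)"
    by (rule eq_matI) (auto simp: scalar_prod_def atLeast0LessThan top)
  have LB: "?L * ?B + ?K' = mat n n (\<lambda>(i, j). K (r + i) (r + j))"
    by (rule eq_matI) (auto simp: scalar_prod_def atLeast0LessThan bot)
  have "?U * ?V = four_block_mat ?D ?B (?L * ?D) (?L * ?B + ?K')"
    by (subst mult_four_block_mat[where ?nr1.0 = r and ?n1.0 = r and ?n2.0 = n and ?nr2.0 = n
          and ?nc1.0 = r and ?nc2.0 = n]) auto
  also have "\<dots> = mat (r + n) (r + n) (\<lambda>(i, j). K i j)"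
    unfolding LD LB by (rule eq_matI) auto
  finally have "det (mat (r + n) (r + n) (\<lambda>(i, j). K i j)) = det ?U * det ?V"
    by (metis (no_types, lifting) det_mult four_block_carrier_mat mat_carrier one_carrier_mat)
  moreover have "det ?U = 1"
    by (subst det_four_block_mat_upper_right_zero[where n = r and m = n]) auto
  moreover have "det ?V = det ?D * det ?K'"
    by (rule det_four_block_mat_lower_left_zero) auto
  ultimately show ?thesis
    by simp
qed

section \<open>The banded Gram matrix and its minors\<close>

text \<open>
  The Toeplitz matrix of the symbol
  \<open>(1 + z) (1 + 1/z) (z\<^sup>2 + z + 1 + z\<^bsup>-1\<^esup> + z\<^bsup>-2\<^esup>)\<close>.
\<close>
definition band :: "nat \<Rightarrow> nat \<Rightarrow> rat" where
  "band i j = (if i = j \<or> i = j + 1 \<or> j = i + 1 then 4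
    else if i = j + 2 \<or> j = i + 2 then 3
    else if i = j + 3 \<or> j = i + 3 then 1 else 0)"

text \<open>
  For \<open>m = 0\<close> these are the numbers \<open>L(p\<^sub>i p\<^sub>j)\<close>, with generating function
  \<open>(u (1 + u)\<^sup>3 - v (1 + v)\<^sup>3) / ((u - v) (1 - u v))\<close>; the corner corrections reduce the first row to
  \<open>1, 3, 3, 1\<close>. For larger \<open>m\<close> they are the iterated Schur complements, whose generating function
  has the additional term \<open>- 5 m u (1 + u) v (1 + v)\<close>.
\<close>
definition gram :: "nat \<Rightarrow> nat \<Rightarrow> nat \<Rightarrow> rat" where
  "gram m i j = band i j - (if i + j = 0 then 3 else if i + j = 1 then 1 else 0)
    - (if i \<in> {1, 2} \<and> j \<in> {1, 2} then 5 * of_nat m else 0)"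

lemma band_Suc_Suc: "band (Suc i) (Suc j) = band i j"
  by (simp add: band_def)

text \<open>
  Away from the border the Toeplitz property suffices. On the border the missing neighbour has to be
  made up for by the corner corrections.
\<close>
lemma gram_commutes: "shift121 (\<lambda>k. gram 0 k l) k = shift121 (gram 0 k) l"
proof -
  have small: "i = 0 \<or> i = 1 \<or> i = 2 \<or> i = 3 \<or> i = 4 \<or> (\<exists>i'. i = i' + 5)" for i :: nat
    by presburger
  consider "k = 0" | "l = 0" | k' l' where "k = Suc k'" "l = Suc l'"
    by (cases k; cases l) auto
  then show ?thesis
  proof cases
    case 1
    show ?thesis
      using small[of l] unfolding 1
      by (elim disjE exE) (simp_all add: shift121_def gram_def band_def)
  next
    case 2
    show ?thesis
      using small[of k] unfolding 2
      by (elim disjE exE) (simp_all add: shift121_def gram_def band_def)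
  next
    case 3
    then show ?thesis
      by (simp add: shift121_def gram_def band_Suc_Suc)
  qed
qed

text \<open>
  The unique solution \<open>L\<close> of \<open>L B = A\<close>, where \<open>B\<close> is the leading \<open>5 \<times> 5\<close> block of \<open>gram m\<close> and \<open>A\<close>
  consists of its first five columns below that block. As the band has width \<open>3\<close>, only the first
  three rows of \<open>A\<close> are nonzero.
\<close>
definition multipliers :: "nat \<Rightarrow> nat \<Rightarrow> nat \<Rightarrow> rat" where
  "multipliers m i q = (let c = 5 * (of_nat m + 1) in
     if 3 \<le> i then 0
     else [[-1, 0, 0, 1, 0],
           [2 * c - 3, - 2 * c, 2 * c + 1, - 2 * c, c],
           [2 * c - 3, 1 - 2 * c, 2 * c, - 2 * c, c]] ! i ! q)"

text \<open>
  The self-reproduction of the matrix: subtracting the given multiples of the first five rows clears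
  the columns below the leading block and turns the remaining part into the next matrix of the
  family. Both effects are finite checks, because beyond column \<open>7\<close> the first five rows vanish.
\<close>
lemma gram_elimination:
  "(\<Sum>q<5. multipliers m i q * gram m q j) =
    gram m (5 + i) j - (if j < 5 then 0 else gram (Suc m) i (j - 5))"
proof -
  have sum5: "(\<Sum>q<5. f q) = f 0 + f 1 + f 2 + f 3 + f 4" for f :: "nat \<Rightarrow> rat"
    by (simp add: eval_nat_numeral)
  have j: "j = 0 \<or> j = 1 \<or> j = 2 \<or> j = 3 \<or> j = 4 \<or> j = 5 \<or> j = 6 \<or> j = 7
      \<or> (\<exists>j'. j = j' + 8)"
    by presburger
  consider "i = 0" | "i = 1" | "i = 2" | "3 \<le> i"
    by linarith
  then show ?thesis
  proof cases
    case 1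
    show ?thesis
      using j unfolding 1
      by (elim disjE exE) (simp_all add: sum5 multipliers_def gram_def band_def algebra_simps)
  next
    case 2
    show ?thesis
      using j unfolding 2
      by (elim disjE exE) (simp_all add: sum5 multipliers_def gram_def band_def algebra_simps)
  next
    case 3
    show ?thesis
      using j unfolding 3
      by (elim disjE exE) (simp_all add: sum5 multipliers_def gram_def band_def algebra_simps)
  next
    case 4
    show ?thesis
    proof (cases "j < 5")
      case True
      with 4 show ?thesis
        by (simp add: multipliers_def gram_def band_def)
    next
      case False
      then obtain j' where "j = 5 + j'"
        using le_Suc_ex not_less by blast
      with 4 show ?thesis
        by (simp add: multipliers_def gram_def band_def)
    qed
  qed
qed

lemma det_gram_step: "det (mat (5 + k) (5 + k) (\<lambda>(i, j). gram m i j))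
    = det (mat 5 5 (\<lambda>(i, j). gram m i j)) * det (mat k k (\<lambda>(i, j). gram (Suc m) i j))"
  by (rule det_block_elimination[where L = "multipliers m"]) (simp_all add: gram_elimination)

text \<open>
  Laplace expansion in a form that keeps the minors as matrices given by index functions, so that it
  can be iterated by rewriting.
\<close>
lemma det_first_row:
  fixes f :: "nat \<Rightarrow> nat \<Rightarrow> 'a::comm_ring_1"
  shows "det (mat (Suc n) (Suc n) (\<lambda>(i, j). f i j)) =
    (\<Sum>c<Suc n. (-1) ^ c * f 0 c *
      det (mat n n (\<lambda>(i, j). f (Suc i) (if j < c then j else Suc j))))"
proof -
  have "det (mat (Suc n) (Suc n) (\<lambda>(i, j). f i j)) =
    (\<Sum>c<Suc n. f 0 c * cofactor (mat (Suc n) (Suc n) (\<lambda>(i, j). f i j)) 0 c)"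
    by (subst laplace_expansion_row[where i = 0 and n = "Suc n"]) (auto intro!: sum.cong)
  also have "\<dots> = (\<Sum>c<Suc n. (-1) ^ c * f 0 c *
      det (mat n n (\<lambda>(i, j). f (Suc i) (if j < c then j else Suc j))))"
  proof (rule sum.cong[OF refl])
    fix c
    have "mat_delete (mat (Suc n) (Suc n) (\<lambda>(i, j). f i j)) 0 c
        = mat n n (\<lambda>(i, j). f (Suc i) (if j < c then j else Suc j))"
      by (rule eq_matI) (auto simp: mat_delete_def)
    then show "f 0 c * cofactor (mat (Suc n) (Suc n) (\<lambda>(i, j). f i j)) 0 c = (-1) ^ c * f 0 c *
        det (mat n n (\<lambda>(i, j). f (Suc i) (if j < c then j else Suc j)))"
      by (simp add: cofactor_def)
  qed
  finally show ?thesis .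
qed

lemma gram_corner:
  "gram m 0 0 = 1" "gram m 0 1 = 3" "gram m 0 2 = 3" "gram m 0 3 = 1" "gram m 0 4 = 0"
  "gram m 1 0 = 3" "gram m 1 1 = 4 - 5 * of_nat m" "gram m 1 2 = 4 - 5 * of_nat m"
  "gram m 1 3 = 3" "gram m 1 4 = 1"
  "gram m 2 0 = 3" "gram m 2 1 = 4 - 5 * of_nat m" "gram m 2 2 = 4 - 5 * of_nat m"
  "gram m 2 3 = 4" "gram m 2 4 = 3"
  "gram m 3 0 = 1" "gram m 3 1 = 3" "gram m 3 2 = 4" "gram m 3 3 = 4" "gram m 3 4 = 4"
  "gram m 4 0 = 0" "gram m 4 1 = 1" "gram m 4 2 = 3" "gram m 4 3 = 4" "gram m 4 4 = 4"
  by (simp_all add: gram_def band_def)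

lemma numerals_as_Suc:
  "1 = Suc 0" "2 = Suc (Suc 0)" "3 = Suc (Suc (Suc 0))" "4 = Suc (Suc (Suc (Suc 0)))"
  "5 = Suc (Suc (Suc (Suc (Suc 0))))"
  by simp_all

lemma det_gram_small:
  "det (mat 0 0 (\<lambda>(i, j). gram m i j)) = 1"
  "det (mat 1 1 (\<lambda>(i, j). gram m i j)) = 1"
  "det (mat 2 2 (\<lambda>(i, j). gram m i j)) = - 5 * (of_nat m + 1)"
  "det (mat 3 3 (\<lambda>(i, j). gram m i j)) = 0"
  "det (mat 4 4 (\<lambda>(i, j). gram m i j)) = 5 * (of_nat m + 1)"
  "det (mat 5 5 (\<lambda>(i, j). gram m i j)) = 1"
  unfolding numerals_as_Suc det_first_row sum.lessThan_Suc lessThan_0 sum.empty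
  by (simp_all add: det_dim_zero gram_corner[unfolded numerals_as_Suc] algebra_simps)

lemma det_gram_periodic:
  "det (mat (5 * n + k) (5 * n + k) (\<lambda>(i, j). gram m i j)) = det (mat k k (\<lambda>(i, j). gram (m + n) i j))"
proof (induction n arbitrary: m)
  case (Suc n)
  have "det (mat (5 * Suc n + k) (5 * Suc n + k) (\<lambda>(i, j). gram m i j))
      = det (mat (5 + (5 * n + k)) (5 + (5 * n + k)) (\<lambda>(i, j). gram m i j))"
    by (simp only: mult_Suc_right add.assoc)
  also have "\<dots> = det (mat (5 * n + k) (5 * n + k) (\<lambda>(i, j). gram (Suc m) i j))"
    by (simp only: det_gram_step det_gram_small mult_1)
  also have "\<dots> = det (mat k k (\<lambda>(i, j). gram (Suc m + n) i j))"
    by (rule Suc.IH)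
  finally show ?case
    by (simp only: add_Suc add_Suc_right)
qed simp

section \<open>Catalan powers in the Chebyshev basis\<close>

text \<open>
  The Riordan array \<open>(C\<^sup>2, x C\<^sup>2)\<close>: \<open>riordan n k\<close> is the coefficient of \<open>p\<^sub>k\<close> in \<open>y\<^sup>n\<close> for the
  Chebyshev basis \<open>p\<^sub>k = (z\<^bsup>k+1\<^esup> - z\<^bsup>-k-1\<^esup>) / (z - 1/z)\<close> with \<open>y = z + 2 + 1/z\<close>.
\<close>
definition riordan :: "nat \<Rightarrow> nat \<Rightarrow> rat" where
  "riordan n k = fps_nth ((fps_X * catalan_fps\<^sup>2) ^ k * catalan_fps\<^sup>2) n"

lemma riordan_eq: "riordan n k = (if n < k then 0 else fps_nth (catalan_fps ^ (2 * k + 2)) (n - k))"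
  by (simp only: riordan_def power_mult_distrib mult.assoc fps_X_power_mult_nth power_add power_mult)

lemma riordan_0: "riordan 0 k = (if k = 0 then 1 else 0)"
  by (simp add: riordan_eq catalan_fps_nth_0 fps_nth_power_0)

lemma riordan_supp: "n < k \<Longrightarrow> riordan n k = 0"
  by (simp add: riordan_eq)

lemma riordan_diag: "riordan i i = 1"
  by (simp add: riordan_eq catalan_fps_nth_0 fps_nth_power_0)

text \<open>
  With \<open>T = x C\<^sup>2 = C - 1\<close> the \<open>k\<close>-th column series is \<open>T\<^sup>k C\<^sup>2 = T\<^sup>k (1 + T)\<^sup>2\<close>, and multiplying a
  column by \<open>x\<close> gives \<open>T\<^bsup>k+1\<^esup>\<close>. Expanding \<open>(1 + T)\<^sup>2\<close> therefore yields the
  recurrence; the summand \<open>1\<close> survives in column \<open>0\<close> only and is the initial row.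
\<close>
lemma riordan_Suc: "riordan (Suc n) = shift121 (riordan n)"
proof (rule ext)
  fix k
  define T where "T = fps_X * catalan_fps\<^sup>2"
  define P where "P k = T ^ k * catalan_fps\<^sup>2" for k
  have nth_P: "riordan n k = fps_nth (P k) n" for n k
    by (simp add: riordan_def P_def T_def)
  have X_P: "fps_X * P k = T ^ Suc k" for k
    by (simp add: P_def T_def)
  have C: "catalan_fps = 1 + T"
    unfolding T_def by (rule catalan_fps_equation)
  have C2: "catalan_fps\<^sup>2 = 1 + 2 * T + T\<^sup>2"
    unfolding C by (simp add: power2_eq_square algebra_simps)
  have P_Suc: "P (Suc l) = fps_X * (P l + 2 * P (Suc l) + P (Suc (Suc l)))" for l
  proof -
    have "P (Suc l) = T ^ Suc l + 2 * T ^ Suc (Suc l) + T ^ Suc (Suc (Suc l))"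
      unfolding P_def C2 by (simp add: power2_eq_square algebra_simps)
    then show ?thesis
      by (simp only: X_P[symmetric]) (simp add: algebra_simps)
  qed
  have P_0: "P 0 = 1 + fps_X * (2 * P 0 + P 1)"
  proof -
    have "P 0 = 1 + (2 * T ^ Suc 0 + T ^ Suc (Suc 0))"
      unfolding P_def C2 by (simp add: power2_eq_square algebra_simps)
    then show ?thesis
      by (simp only: X_P[symmetric]) (simp add: algebra_simps)
  qed
  show "riordan (Suc n) k = shift121 (riordan n) k"
  proof (cases k)
    case 0
    have "riordan (Suc n) 0 = fps_nth (1 + fps_X * (2 * P 0 + P 1)) (Suc n)"
      unfolding nth_P using P_0 by simp
    then show ?thesis
      by (simp add: 0 shift121_def nth_P numeral_fps_const)
  next
    case (Suc l)
    have "riordan (Suc n) (Suc l) = fps_nth (fps_X * (P l + 2 * P (Suc l) + P (Suc (Suc l)))) (Suc n)"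
      unfolding nth_P using P_Suc by simp
    then show ?thesis
      by (simp add: Suc shift121_def nth_P numeral_fps_const)
  qed
qed

text \<open>
  The values \<open>L(p\<^sub>l) = 1, 3, 3, 1\<close>: they are the binomial coefficients of
  \<open>C\<^sup>5 = (1 + x C\<^sup>2)\<^sup>3 C\<^sup>2\<close>, and also the first row of \<open>gram 0\<close>.
\<close>
lemma F5_nth: "fps_nth (F 5) n = riordan n 0 + 3 * riordan n 1 + 3 * riordan n 2 + riordan n 3"
proof -
  define T where "T = fps_X * catalan_fps\<^sup>2"
  have C: "catalan_fps = 1 + T"
    unfolding T_def by (rule catalan_fps_equation)
  have C3: "catalan_fps ^ 3 = 1 + 3 * T + 3 * T\<^sup>2 + T ^ 3"
    unfolding C by (simp add: power2_eq_square power3_eq_cube algebra_simps)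
  have "F 5 = catalan_fps ^ 3 * catalan_fps\<^sup>2"
    by (simp add: F_def flip: power_add)
  also have "\<dots> = T ^ 0 * catalan_fps\<^sup>2 + 3 * (T ^ 1 * catalan_fps\<^sup>2)
      + 3 * (T ^ 2 * catalan_fps\<^sup>2) + T ^ 3 * catalan_fps\<^sup>2"
    unfolding C3 by (simp add: algebra_simps)
  finally show ?thesis
    unfolding riordan_def T_def by (simp add: numeral_fps_const)
qed

lemma F5_factorization:
  assumes "i < n" "j < n"
  shows "fps_nth (F 5) (i + j) = (\<Sum>k<n. \<Sum>l<n. riordan i k * gram 0 k l * riordan j l)"
proof -
  \<comment> \<open>Moving all powers of \<open>y\<close> to one side needs indices up to \<open>i + j\<close>, beyond the range \<open>k, l < n\<close>, and
    the first row of \<open>gram 0\<close> needs four; \<open>N\<close> is large enough for both.\<close>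
  define N where "N = 2 * n + 4"
  have "(\<Sum>k<n. \<Sum>l<n. riordan i k * gram 0 k l * riordan j l)
      = (\<Sum>k<N. \<Sum>l<N. riordan i k * gram 0 k l * riordan j l)"
    using assms by (intro sum.mono_neutral_cong_left)
      (auto simp: N_def riordan_supp intro!: sum.mono_neutral_left)
  also have "\<dots> = (\<Sum>l<N. gram 0 0 l * riordan (i + j) l)"
    using assms by (intro hankel_of_commuting_form)
      (auto simp: riordan_0 riordan_Suc riordan_supp gram_commutes N_def)
  also have "\<dots> = (\<Sum>l<4. gram 0 0 l * riordan (i + j) l)"
    by (rule sum.mono_neutral_right) (auto simp: N_def gram_def band_def)
  also have "\<dots> = fps_nth (F 5) (i + j)"
    unfolding F5_nth by (simp add: eval_nat_numeral gram_def band_def)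
  finally show ?thesis
    by simp
qed

lemma hankel_det_F5: "hankel_det (F 5) n = det (mat n n (\<lambda>(i, j). gram 0 i j))"
proof -
  have "mat n n (\<lambda>(i, j). fps_nth (F 5) (i + j))
      = mat n n (\<lambda>(i, j). \<Sum>k<n. \<Sum>l<n. riordan i k * gram 0 k l * riordan j l)"
    by (rule eq_matI) (auto simp: F5_factorization)
  then show ?thesis
    unfolding hankel_det_def
    by (simp add: det_unitriangular_congruence riordan_diag riordan_supp)
qed

theorem theorem3:
  fixes n :: nat
  shows "hankel_det (F 5) (5 * n) = 1 \<and>
    hankel_det (F 5) (5 * n + 1) = 1 \<and>
    hankel_det (F 5) (5 * n + 2) = - 5 * (of_nat n + 1) \<and>
    - hankel_det (F 5) (5 * n + 4) = - 5 * (of_nat n + 1) \<and>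
    hankel_det (F 5) (5 * n + 3) = 0"
proof -
  have "hankel_det (F 5) (5 * n + k) = det (mat k k (\<lambda>(i, j). gram n i j))" for k
    unfolding hankel_det_F5 det_gram_periodic by simp
  from this[of 0] this[of 1] this[of 2] this[of 3] this[of 4] show ?thesis
    unfolding det_gram_small by simp
qed

end
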